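(* Let $E(q)=\prod_{k\ge1}(1-q^k)$, $$X=\frac{E(q^2)^4E(q^3)^8}{E(q)^8E(q^6)^4},\qquad \xi=q^{-2}\frac{E(q^2)^5E(q^9)^4}{E(q)^4E(q^{18})^5},$$ and let $U$ be the operator on formal Laurent series defined by $U\left(\sum_{n\ge n_0}a_nq^n\right)=\sum_{3n\ge n_0}a_{3n}q^n$. Then \begin{align*} U(\xi)&=9X,\\ U(\xi X)&=-9X+252X^2-891X^3+729X^4,\\ U(\xi X^2)&=X-378X^2+8613X^3-54675X^4+138510X^5-150903X^6+59049X^7,\\ U(\xi X^3)&=147X^2-14553X^3+312255X^4-2617839X^5+10764414X^6\\ &\qquad-23914845X^7+29288304X^8-18600435X^9+4782969X^{10}. \end{align*}
   Context: All identities are identities of formal Laurent series in $q$. *)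

theory Defs
  imports "HOL-Computational_Algebra.Formal_Laurent_Series"
begin

text \<open>Euler product E(q) = prod_{k>=1} (1 - q^k), as the limit (in the usual
  q-adic topology of formal power series) of its finite partial products.\<close>
definition euler_E :: "rat fps" where
  "euler_E = lim (\<lambda>N. \<Prod>k\<in>{1..N}. (1 - fps_X ^ k))"

definition Eq :: "nat \<Rightarrow> rat fls" where
  "Eq m = fls_compose_power (fps_to_fls euler_E) m"

definition Xs :: "rat fls" where
  "Xs = (Eq 2 ^ 4 * Eq 3 ^ 8) / (Eq 1 ^ 8 * Eq 6 ^ 4)"

definition xi :: "rat fls" where
  "xi = fls_X_intpow (-2) * ((Eq 2 ^ 5 * Eq 9 ^ 4) / (Eq 1 ^ 4 * Eq 18 ^ 5))"

lift_definition U3 :: "'a::zero fls \<Rightarrow> 'a fls" is "\<lambda>f n. f (3 * n)"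
proof -
  fix f :: "int \<Rightarrow> 'a"
  assume *: "eventually (\<lambda>n. f (-int n) = 0) cofinite"
  hence "eventually (\<lambda>n. f (-int n) = 0) at_top"
    by (simp add: cofinite_eq_sequentially)
  hence "eventually (\<lambda>n. f (-int (3 * n)) = 0) at_top"
    by (rule eventually_compose_filterlim) (simp add: filterlim_subseq strict_mono_def)
  thus "eventually (\<lambda>n. f (3 * (-int n)) = 0) cofinite"
    by (simp add: cofinite_eq_sequentially)
qed

end

theory Submission
  imports Defs
begin

text \<open>
  Write \<open>\<phi> = E(q)\<^sup>2/E(q\<^sup>2)\<close> and \<open>\<psi> = E(q\<^sup>2)\<^sup>2/E(q)\<close>, so that \<open>X = \<phi>(q\<^sup>3)\<^sup>4/\<phi>(q)\<^sup>4\<close> and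
  \<open>\<xi> = q\<^sup>-\<^sup>2 \<psi>(q)\<^sup>2 \<phi>(q\<^sup>9) / (\<phi>(q) \<psi>(q\<^sup>9)\<^sup>2)\<close>. By the Jacobi triple product both are theta series, and
  splitting the summation index modulo 3 gives \<open>\<phi>(q) = \<phi>(q\<^sup>9) (1 - 2t)\<close> and
  \<open>\<psi>(q) = q \<psi>(q\<^sup>9) (1 + 1/t)\<close> with one and the same series \<open>t\<close>, whose exponents are all 1 modulo 3.
  Multiplying the conjugates of \<open>\<phi>\<close> under \<open>q \<mapsto> \<omega>q\<close>, where \<open>\<omega>\<^sup>3 = 1\<close>, gives \<open>\<phi>(q\<^sup>3)\<^sup>4 = \<phi>(q\<^sup>9)\<^sup>4 (1 - 8t\<^sup>3)\<close>.
  Hence \<open>\<xi> = (1 + t)\<^sup>2 / (t\<^sup>2 (1 - 2t))\<close>, \<open>X = (1 - 8t\<^sup>3) / (1 - 2t)\<^sup>4\<close> and \<open>X(q\<^sup>3) = 1 / (1 - 8t\<^sup>3)\<close>. After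
  rewriting \<open>1 / (1 - 2t)\<close> as \<open>(1 + 2t + 4t\<^sup>2) X(q\<^sup>3)\<close>, applying \<open>U\<close> to \<open>\<xi> X\<^sup>k\<close> amounts to picking the
  powers of \<open>t\<close> with exponent divisible by 3 from a polynomial.
\<close>

subsection \<open>Limits of formal power series and Euler products\<close>

text \<open>Convergence means that each coefficient is eventually constant, and coefficient n of a
  product depends only on the coefficients up to n of the factors.\<close>

lemma tendsto_mult_fps:
  fixes f g :: "'b \<Rightarrow> 'a :: ring fps"
  assumes "(f \<longlongrightarrow> a) F" and "(g \<longlongrightarrow> b) F"
  shows "((\<lambda>x. f x * g x) \<longlongrightarrow> a * b) F"
proof (rule tendsto_fpsI)
  fix n :: nat
  have "eventually (\<lambda>x. \<forall>i\<in>{..n}. f x $ i = a $ i) F" "eventually (\<lambda>x. \<forall>i\<in>{..n}. g x $ i = b $ i) F"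
    using assms by (simp_all add: tendsto_fps_iff eventually_ball_finite_distrib)
  thus "eventually (\<lambda>x. (f x * g x) $ n = (a * b) $ n) F"
    by eventually_elim (simp add: fps_mult_nth)
qed

lemma tendsto_power_fps:
  fixes f :: "'b \<Rightarrow> 'a :: ring_1 fps"
  assumes "(f \<longlongrightarrow> a) F"
  shows "((\<lambda>x. f x ^ n) \<longlongrightarrow> a ^ n) F"
  by (induction n) (auto intro: tendsto_mult_fps assms)

lemma tendsto_add_fps:
  fixes f g :: "'b \<Rightarrow> 'a :: ab_group_add fps"
  assumes "(f \<longlongrightarrow> a) F" and "(g \<longlongrightarrow> b) F"
  shows "((\<lambda>x. f x + g x) \<longlongrightarrow> a + b) F"
proof (rule tendsto_fpsI)
  fix n :: nat
  have "eventually (\<lambda>x. f x $ n = a $ n) F" "eventually (\<lambda>x. g x $ n = b $ n) F"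
    using assms by (simp_all add: tendsto_fps_iff)
  thus "eventually (\<lambda>x. (f x + g x) $ n = (a + b) $ n) F"
    by eventually_elim simp
qed

lemma LIMSEQ_mult_index:
  assumes "f \<longlonglongrightarrow> L" and "c > (0::nat)"
  shows "(\<lambda>N. f (c * N)) \<longlonglongrightarrow> L"
  using LIMSEQ_subseq_LIMSEQ[OF assms(1), of "\<lambda>N. c * N"] assms(2)
  by (simp add: strict_mono_def comp_def)

section \<open>Finite and infinite q-Pochhammer products\<close>

definition qpoch :: "'a :: field fps \<Rightarrow> nat \<Rightarrow> 'a fps" where
  "qpoch p n = (\<Prod>k\<in>{1..n}. 1 - p ^ k)"

text \<open>If \<open>p\<close> has zero constant term, the factors beyond the n-th do not touch
  coefficient n, so the diagonal coefficients are those of the limit.\<close>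

definition qpoch_inf :: "'a :: field fps \<Rightarrow> 'a fps" where
  "qpoch_inf p = Abs_fps (\<lambda>n. qpoch p n $ n)"

lemma qpoch_0 [simp]: "qpoch p 0 = 1"
  and qpoch_Suc: "qpoch p (Suc n) = qpoch p n * (1 - p ^ Suc n)"
  by (simp_all add: qpoch_def)

lemma qpoch_nth_0 [simp]: "p $ 0 = 0 \<Longrightarrow> qpoch p n $ 0 = 1"
  by (induction n) (simp_all add: qpoch_Suc)

lemma qpoch_nonzero: "p $ 0 = 0 \<Longrightarrow> qpoch p n \<noteq> 0"
  using qpoch_nth_0[of p n] by (metis fps_zero_nth zero_neq_one)

lemma qpoch_nth_stable:
  assumes "p $ 0 = 0" and "N \<ge> n"
  shows "qpoch p N $ n = qpoch p n $ n"
  using assms(2)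
proof (induction N rule: dec_induct)
  case (step N)
  have "(qpoch p N * p ^ Suc N) $ n = 0"
    unfolding fps_mult_nth using step.hyps startsby_zero_power_prefix[OF assms(1), of "Suc N"]
    by (intro sum.neutral) auto
  with step show ?case
    by (simp add: qpoch_Suc right_diff_distrib)
qed simp

lemma qpoch_tendsto: "p $ 0 = 0 \<Longrightarrow> qpoch p \<longlonglongrightarrow> qpoch_inf p"
proof (rule tendsto_fpsI)
  fix n assume p: "p $ 0 = 0"
  show "\<forall>\<^sub>F N in sequentially. qpoch p N $ n = qpoch_inf p $ n"
    using eventually_ge_at_top[of n] by eventually_elim (auto simp: qpoch_inf_def intro: qpoch_nth_stable[OF p])
qed

lemma qpoch_inf_nth_0 [simp]: "qpoch_inf p $ 0 = 1"
  by (simp add: qpoch_inf_def)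

lemma qpoch_inf_nonzero [simp]: "qpoch_inf p \<noteq> 0"
  using qpoch_inf_nth_0[of p] by (metis fps_zero_nth zero_neq_one)

lemma qpoch_inf_compose_X_power:
  assumes "m > 0"
  shows "qpoch_inf fps_X oo fps_X ^ m = qpoch_inf (fps_X ^ m :: 'a :: field fps)"
proof (rule LIMSEQ_unique)
  have "qpoch fps_X N oo fps_X ^ m = qpoch (fps_X ^ m :: 'a fps) N" for N
    using assms by (induction N)
      (simp_all add: qpoch_Suc fps_compose_mult_distrib fps_compose_sub_distrib fps_X_fps_compose_startby0
         fps_compose_power[symmetric] del: power_Suc)
  moreover have "(\<lambda>N. qpoch fps_X N oo fps_X ^ m) \<longlonglongrightarrow> (qpoch_inf fps_X oo fps_X ^ m :: 'a fps)"
    using qpoch_tendsto[of "fps_X :: 'a fps"] by (simp add: tendsto_fps_iff fps_nth_compose_X_power)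
  ultimately show "qpoch (fps_X ^ m) \<longlonglongrightarrow> (qpoch_inf fps_X oo fps_X ^ m :: 'a fps)"
    by simp
  show "qpoch (fps_X ^ m :: 'a fps) \<longlonglongrightarrow> qpoch_inf (fps_X ^ m)"
    using assms by (intro qpoch_tendsto) simp
qed

lemma Eq_conv_qpoch_inf:
  assumes "m > 0"
  shows "Eq m = fps_to_fls (qpoch_inf (fps_X ^ m))"
proof -
  have "euler_E = lim (qpoch fps_X)"
    unfolding euler_E_def by (intro arg_cong[of _ _ lim] ext) (simp add: qpoch_def)
  also have "\<dots> = qpoch_inf fps_X"
    by (intro limI qpoch_tendsto) simp
  finally have E: "euler_E = qpoch_inf fps_X" .
  show ?thesis
    unfolding Eq_def E using assms by (simp add: fls_compose_power_fps_to_fls qpoch_inf_compose_X_power)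
qed

subsection \<open>The Jacobi triple product\<close>

definition qbinom :: "'a :: field fps \<Rightarrow> nat \<Rightarrow> nat \<Rightarrow> 'a fps" where
  "qbinom p n j = (if j \<le> n then qpoch p n * inverse (qpoch p j * qpoch p (n - j)) else 0)"

lemma qbinom_qpoch:
  assumes "p $ 0 = 0" "j \<le> n"
  shows "qbinom p n j * (qpoch p j * qpoch p (n - j)) = qpoch p n"
  using assms by (simp add: qbinom_def mult.assoc inverse_mult_eq_1)

lemma qbinom_0 [simp]: "p $ 0 = 0 \<Longrightarrow> qbinom p n 0 = 1"
  and qbinom_self [simp]: "p $ 0 = 0 \<Longrightarrow> qbinom p n n = 1"
  by (simp_all add: qbinom_def inverse_mult_eq_1')

lemma qbinom_beyond: "j > n \<Longrightarrow> qbinom p n j = 0"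
  by (simp add: qbinom_def)

text \<open>For j < n, over the common denominator \<open>?u\<close>, both q-Pascal rules reduce to
  1 - p^(a+b) = (1 - p^a) + p^a (1 - p^b) with a = j+1 and b = d+1, or with a and b
  exchanged.\<close>

lemma
  assumes p: "p $ 0 = 0" and "j \<le> n"
  shows qbinom_Suc_Suc: "qbinom p (Suc n) (Suc j) = qbinom p n j + p ^ Suc j * qbinom p n (Suc j)"
    and qbinom_Suc_Suc': "qbinom p (Suc n) (Suc j) = p ^ (n - j) * qbinom p n j + qbinom p n (Suc j)"
proof -
  have "qbinom p (Suc n) (Suc j) = qbinom p n j + p ^ Suc j * qbinom p n (Suc j) \<and>
        qbinom p (Suc n) (Suc j) = p ^ (n - j) * qbinom p n j + qbinom p n (Suc j)"
  proof (cases "j = n")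
    case False
    with \<open>j \<le> n\<close> obtain d where d: "n = Suc (j + d)"
      by (metis le_neq_implies_less less_iff_Suc_add)
    let ?u = "qpoch p (Suc j) * qpoch p (Suc d)"
    have 1: "qbinom p (Suc n) (Suc j) * ?u = qpoch p n * (1 - p ^ (Suc j + Suc d))"
      using qbinom_qpoch[OF p, of "Suc j" "Suc n"] by (simp add: d qpoch_Suc del: power_Suc)
    have 2: "qbinom p n j * ?u = qpoch p n * (1 - p ^ Suc j)"
      using qbinom_qpoch[OF p, of j n] by (simp add: d qpoch_Suc mult_ac del: power_Suc)
    have 3: "qbinom p n (Suc j) * ?u = qpoch p n * (1 - p ^ Suc d)"
      using qbinom_qpoch[OF p, of "Suc j" n] by (simp add: d qpoch_Suc mult_ac del: power_Suc)
    have "qbinom p (Suc n) (Suc j) * ?u = (qbinom p n j + p ^ Suc j * qbinom p n (Suc j)) * ?u"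
      unfolding distrib_right mult.assoc[of "p ^ _"] 1 2 3 power_add by (simp add: algebra_simps)
    moreover have "qbinom p (Suc n) (Suc j) * ?u = (p ^ Suc d * qbinom p n j + qbinom p n (Suc j)) * ?u"
      unfolding distrib_right mult.assoc[of "p ^ _"] 1 2 3 power_add by (simp add: algebra_simps)
    moreover have "?u \<noteq> 0"
      using p by (simp add: qpoch_nonzero)
    ultimately show ?thesis
      by (simp only: mult_cancel_right) (simp add: d)
  qed (use p in \<open>simp add: qbinom_beyond\<close>)
  thus "qbinom p (Suc n) (Suc j) = qbinom p n j + p ^ Suc j * qbinom p n (Suc j)"
    and "qbinom p (Suc n) (Suc j) = p ^ (n - j) * qbinom p n j + qbinom p n (Suc j)"
    by blast+
qed

definition tri :: "int \<Rightarrow> nat" where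
  "tri k = nat (k * (k + 1) div 2)"

lemma int_tri: "2 * int (tri k) = k * (k + 1)"
proof -
  have "k * (k + 1) \<ge> 0"
    by (cases "k \<ge> 0") (simp_all add: mult_nonpos_nonpos)
  thus ?thesis by (simp add: tri_def)
qed

text \<open>Ramanujan's \<open>f(x, y)\<close>: its exponents \<open>k(k+1)/2\<close> and \<open>k(k-1)/2\<close> are nonnegative for every integer \<open>k\<close>.\<close>

definition theta_term :: "'a :: field fps \<Rightarrow> 'a fps \<Rightarrow> int \<Rightarrow> 'a fps" where
  "theta_term x y k = x ^ tri k * y ^ tri (k - 1)"

lemma theta_term_0 [simp]: "theta_term x y 0 = 1"
  by (simp add: theta_term_def tri_def)

text \<open>Consecutive terms have ratio x (xy)^k; the extra factor (xy)^(M-k) avoids negative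
  powers when k < 0.\<close>

lemma theta_term_step_x:
  assumes "k \<le> int M"
  shows "x * (x * y) ^ M * theta_term x y k = (x * y) ^ nat (int M - k) * theta_term x y (k + 1)"
proof -
  have "int (Suc (M + tri k)) = int (nat (int M - k) + tri (k + 1))"
       "int (M + tri (k - 1)) = int (nat (int M - k) + tri k)"
    using assms int_tri[of k] int_tri[of "k + 1"] int_tri[of "k - 1"]
    by (simp_all add: algebra_simps)
  hence "Suc (M + tri k) = nat (int M - k) + tri (k + 1)"
        "M + tri (k - 1) = nat (int M - k) + tri k"
    by (simp_all only: of_nat_eq_iff)
  hence "x ^ Suc (M + tri k) * y ^ (M + tri (k - 1)) =
         x ^ (nat (int M - k) + tri (k + 1)) * y ^ (nat (int M - k) + tri k)"
    by (simp only:)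
  thus ?thesis
    by (simp add: theta_term_def power_add power_mult_distrib mult_ac)
qed

lemma theta_term_step_y:
  assumes "- k \<le> int N"
  shows "y * (x * y) ^ N * theta_term x y k = (x * y) ^ nat (int N + k) * theta_term x y (k - 1)"
proof -
  have "int (N + tri k) = int (nat (int N + k) + tri (k - 1))"
       "int (Suc (N + tri (k - 1))) = int (nat (int N + k) + tri (k - 2))"
    using assms int_tri[of k] int_tri[of "k - 1"] int_tri[of "k - 2"]
    by (simp_all add: algebra_simps)
  hence "N + tri k = nat (int N + k) + tri (k - 1)"
        "Suc (N + tri (k - 1)) = nat (int N + k) + tri (k - 2)"
    by (simp_all only: of_nat_eq_iff)
  hence "x ^ (N + tri k) * y ^ Suc (N + tri (k - 1)) =
         x ^ (nat (int N + k) + tri (k - 1)) * y ^ (nat (int N + k) + tri (k - 2))"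
    by (simp only:)
  thus ?thesis
    by (simp add: theta_term_def power_add power_mult_distrib mult_ac)
qed

text \<open>Cauchy's finite form. A new y-factor shifts the index down by one, a new x-factor up by
  one. The q-Pascal rules recombine the coefficients: the first in the induction on N at M = 0, the
  second in that on M.\<close>

lemma finite_jacobi_triple:
  fixes x y :: "'a :: field fps"
  defines "p \<equiv> x * y"
  assumes p: "p $ 0 = 0"
  shows "(\<Prod>i<M. 1 + x * p ^ i) * (\<Prod>i<N. 1 + y * p ^ i) =
         (\<Sum>j\<le>M+N. qbinom p (M + N) j * theta_term x y (int j - int N))"
proof (induction M)
  case 0
  show ?case
  proof (induction N)
    case (Suc N)
    let ?m = "\<lambda>j. theta_term x y (int j - int (Suc N))"
    have "(\<Prod>i<Suc N. 1 + y * p ^ i) =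
          (\<Sum>j\<le>N. qbinom p N j * ((1 + y * p ^ N) * theta_term x y (int j - int N)))"
      using Suc.IH by (simp add: sum_distrib_left mult_ac)
    also have "\<dots> = (\<Sum>j\<le>N. qbinom p N j * (?m (Suc j) + p ^ j * ?m j))"
    proof (intro sum.cong refl arg_cong2[of _ _ _ _ "(*)"])
      fix j assume "j \<in> {..N}"
      thus "(1 + y * p ^ N) * theta_term x y (int j - int N) = ?m (Suc j) + p ^ j * ?m j"
        using theta_term_step_y[of "int j - int N" N y x]
        by (simp add: p_def distrib_right algebra_simps)
    qed
    also have "\<dots> = (\<Sum>j\<le>N. qbinom p N j * ?m (Suc j)) + (\<Sum>j\<le>Suc N. p ^ j * qbinom p N j * ?m j)"
      by (simp add: sum.distrib distrib_left qbinom_beyond mult_ac)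
    also have "\<dots> = qbinom p N 0 * ?m 0 +
        (\<Sum>j\<le>N. (qbinom p N j + p ^ Suc j * qbinom p N (Suc j)) * ?m (Suc j))"
      by (subst sum.atMost_Suc_shift) (simp add: sum.distrib distrib_right algebra_simps)
    also have "\<dots> = (\<Sum>j\<le>Suc N. qbinom p (Suc N) j * ?m j)"
      by (subst sum.atMost_Suc_shift) (simp add: qbinom_Suc_Suc p)
    finally show ?case by simp
  qed (use p in simp)
next
  case (Suc M)
  let ?m = "\<lambda>j. theta_term x y (int j - int N)" and ?n = "M + N"
  have "(\<Prod>i<Suc M. 1 + x * p ^ i) * (\<Prod>i<N. 1 + y * p ^ i) =
        (\<Sum>j\<le>?n. qbinom p ?n j * ((1 + x * p ^ M) * ?m j))"
    using Suc.IH by (simp add: sum_distrib_left mult_ac)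
  also have "\<dots> = (\<Sum>j\<le>?n. qbinom p ?n j * (?m j + p ^ (?n - j) * ?m (Suc j)))"
  proof (intro sum.cong refl arg_cong2[of _ _ _ _ "(*)"])
    fix j assume "j \<in> {..?n}"
    moreover from this have "nat (int M - (int j - int N)) = ?n - j"
      by auto
    ultimately show "(1 + x * p ^ M) * ?m j = ?m j + p ^ (?n - j) * ?m (Suc j)"
      using theta_term_step_x[of "int j - int N" M x y]
      by (simp add: p_def distrib_right algebra_simps)
  qed
  also have "\<dots> = (\<Sum>j\<le>Suc ?n. qbinom p ?n j * ?m j) + (\<Sum>j\<le>?n. p ^ (?n - j) * qbinom p ?n j * ?m (Suc j))"
    by (simp add: sum.distrib distrib_left qbinom_beyond mult_ac)
  also have "\<dots> = qbinom p ?n 0 * ?m 0 +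
      (\<Sum>j\<le>?n. (p ^ (?n - j) * qbinom p ?n j + qbinom p ?n (Suc j)) * ?m (Suc j))"
    by (subst sum.atMost_Suc_shift) (simp add: sum.distrib distrib_right algebra_simps)
  also have "\<dots> = (\<Sum>j\<le>Suc ?n. qbinom p (Suc ?n) j * ?m j)"
    by (subst sum.atMost_Suc_shift) (simp add: qbinom_Suc_Suc' p)
  finally show ?case by simp
qed

section \<open>Bilateral theta series and the limit of the finite identity\<close>

definition theta :: "'a :: field fps \<Rightarrow> 'a fps \<Rightarrow> 'a fps" where
  "theta x y = Abs_fps (\<lambda>n. \<Sum>k\<in>{-int n..int n}. theta_term x y k $ n)"

text \<open>The two exponents add up to k^2, so the term has order at least k^2 >= |k| > n. Hence
  the truncation in \<open>theta\<close> omits only vanishing terms.\<close>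

lemma theta_term_nth_eq_0:
  assumes "x $ 0 = 0" "y $ 0 = 0" "k \<notin> {-int n..int n}"
  shows "theta_term x y k $ n = 0"
proof -
  have "int (tri k + tri (k - 1)) = k * k"
    using int_tri[of k] int_tri[of "k - 1"] by (simp add: algebra_simps)
  moreover have "int n < k * k"
  proof -
    have "int n < \<bar>k\<bar>" using assms(3) by auto
    also have "\<bar>k\<bar> * 1 \<le> \<bar>k\<bar> * \<bar>k\<bar>" using assms(3) by (intro mult_left_mono) auto
    finally show ?thesis by simp
  qed
  ultimately have "n < tri k + tri (k - 1)" by linarith
  hence "i < tri k \<or> n - i < tri (k - 1)" if "i \<le> n" for i
    using that by linarith
  thus ?thesis
    unfolding theta_term_def fps_mult_nth
    using startsby_zero_power_prefix[OF assms(1), of "tri k"]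
      startsby_zero_power_prefix[OF assms(2), of "tri (k - 1)"]
    by (intro sum.neutral ballI) (auto simp: mult_eq_0_iff)
qed

text \<open>Coefficient n sees only the finitely many k with |k| <= n, whose weights eventually
  agree with 1 up to order n. General sets \<open>A N\<close> admit the lopsided ranges that arise
  in dissections.\<close>

lemma weighted_theta_sum_tendsto:
  fixes x y :: "'a :: field fps"
  assumes xy: "x $ 0 = 0" "y $ 0 = 0"
    and A: "\<And>N. finite (A N)" "\<And>N. {-int N..int N} \<subseteq> A N"
    and c: "\<And>k. (\<lambda>N. c N k) \<longlonglongrightarrow> 1"
  shows "(\<lambda>N. \<Sum>k\<in>A N. c N k * theta_term x y k) \<longlonglongrightarrow> theta x y"
proof (rule tendsto_fpsI)
  fix n :: nat
  have "(\<lambda>N. c N k * theta_term x y k) \<longlonglongrightarrow> 1 * theta_term x y k" for k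
    by (intro tendsto_mult_fps c tendsto_const)
  hence "\<forall>\<^sub>F N in sequentially. \<forall>k\<in>{-int n..int n}. (c N k * theta_term x y k) $ n = theta_term x y k $ n"
    by (simp add: tendsto_fps_iff eventually_ball_finite_distrib)
  thus "\<forall>\<^sub>F N in sequentially. (\<Sum>k\<in>A N. c N k * theta_term x y k) $ n = theta x y $ n"
    using eventually_ge_at_top[of n]
  proof eventually_elim
    case (elim N)
    have "(\<Sum>k\<in>A N. c N k * theta_term x y k) $ n = (\<Sum>k\<in>A N. (c N k * theta_term x y k) $ n)"
      by (simp add: fps_sum_nth)
    also have "\<dots> = (\<Sum>k\<in>{-int n..int n}. (c N k * theta_term x y k) $ n)"
    proof (intro sum.mono_neutral_right ballI A(1))
      show "{-int n..int n} \<subseteq> A N"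
        using A(2)[of N] elim by fastforce
      fix k assume "k \<in> A N - {-int n..int n}"
      hence "theta_term x y k $ i = 0" if "i \<le> n" for i
        using that by (intro theta_term_nth_eq_0 xy) auto
      thus "(c N k * theta_term x y k) $ n = 0"
        by (simp add: fps_mult_nth)
    qed
    also have "\<dots> = theta x y $ n"
      using elim by (simp add: theta_def)
    finally show ?case .
  qed
qed

lemma theta_sum_tendsto:
  fixes x y :: "'a :: field fps"
  assumes "x $ 0 = 0" "y $ 0 = 0" "\<And>N. finite (A N)" "\<And>N. {-int N..int N} \<subseteq> A N"
  shows "(\<lambda>N. \<Sum>k\<in>A N. theta_term x y k) \<longlonglongrightarrow> theta x y"
  using weighted_theta_sum_tendsto[OF assms, where c = "\<lambda>_ _. 1"] by simp

text \<open>All four q-Pochhammer symbols tend to the same limit L, and L * L / (L * L) = 1. This is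
  the weight of theta term k in the finite identity with M = N.\<close>

lemma qbinom_central_tendsto:
  assumes p: "p $ 0 = 0"
  shows "(\<lambda>N. qpoch p N * qbinom p (2 * N) (nat (int N + k))) \<longlonglongrightarrow> 1"
proof -
  let ?L = "qpoch_inf p"
  note lim = qpoch_tendsto[OF p]
  have idx: "filterlim (\<lambda>N. nat (int N + l)) sequentially sequentially" for l
    unfolding filterlim_at_top
  proof
    fix Z
    show "\<forall>\<^sub>F N in sequentially. Z \<le> nat (int N + l)"
      using eventually_ge_at_top[of "Z + nat \<bar>l\<bar>"] by eventually_elim linarith
  qed
  have "(\<lambda>N. qpoch p N * (qpoch p (2 * N) * inverse (qpoch p (nat (int N + k)) * qpoch p (nat (int N + (- k))))))
          \<longlonglongrightarrow> ?L * (?L * inverse (?L * ?L))"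
    by (intro tendsto_mult_fps tendsto_inverse_fps filterlim_compose[OF lim idx] lim
          LIMSEQ_mult_index[OF lim]) simp_all
  also have "?L * (?L * inverse (?L * ?L)) = 1"
    by (subst mult.assoc[symmetric], subst inverse_mult_eq_1') simp_all
  finally show ?thesis
  proof (rule Lim_transform_eventually)
    show "\<forall>\<^sub>F N in sequentially. qpoch p N * (qpoch p (2 * N) *
        inverse (qpoch p (nat (int N + k)) * qpoch p (nat (int N + (- k))))) =
        qpoch p N * qbinom p (2 * N) (nat (int N + k))"
      using eventually_ge_at_top[of "nat \<bar>k\<bar>"]
    proof eventually_elim
      case (elim N)
      hence "nat (int N + k) \<le> 2 * N" "2 * N - nat (int N + k) = nat (int N + (- k))"
        by linarith+
      thus ?case by (simp add: qbinom_def)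
    qed
  qed
qed

text \<open>Kept as a limit of finite stages, so that later product evaluations need only compare
  finite products.\<close>

theorem jacobi_triple_tendsto:
  fixes x y :: "'a :: field fps"
  assumes xy: "x $ 0 = 0" "y $ 0 = 0"
  shows "(\<lambda>N. qpoch (x * y) N * (\<Prod>i<N. (1 + x * (x * y) ^ i) * (1 + y * (x * y) ^ i))) \<longlonglongrightarrow> theta x y"
proof -
  let ?p = "x * y"
  have p: "?p $ 0 = 0" using xy by simp
  have "qpoch ?p N * (\<Prod>i<N. (1 + x * ?p ^ i) * (1 + y * ?p ^ i)) =
        (\<Sum>k\<in>{-int N..int N}. (qpoch ?p N * qbinom ?p (2 * N) (nat (int N + k))) * theta_term x y k)" for N
  proof -
    have "qpoch ?p N * (\<Prod>i<N. (1 + x * ?p ^ i) * (1 + y * ?p ^ i)) =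
          (\<Sum>j\<le>2*N. qpoch ?p N * qbinom ?p (2 * N) j * theta_term x y (int j - int N))"
      using finite_jacobi_triple[OF p, of N N]
      by (simp add: prod.distrib sum_distrib_left mult.assoc flip: mult_2)
    also have "\<dots> = (\<Sum>k\<in>{-int N..int N}. (qpoch ?p N * qbinom ?p (2 * N) (nat (int N + k))) * theta_term x y k)"
      by (rule sum.reindex_bij_witness[where j = "\<lambda>j. int j - int N" and i = "\<lambda>k. nat (int N + k)"]) auto
    finally show ?thesis .
  qed
  thus ?thesis
    using weighted_theta_sum_tendsto[OF xy _ _ qbinom_central_tendsto[OF p], of "\<lambda>N. {-int N..int N}"]
    by simp
qed

text \<open>The product side is symmetric in x and y.\<close>

lemma theta_commute:
  assumes "x $ 0 = 0" "y $ 0 = 0"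
  shows "theta x y = theta y x"
proof (rule LIMSEQ_unique)
  show "(\<lambda>N. qpoch (x * y) N * (\<Prod>i<N. (1 + x * (x * y) ^ i) * (1 + y * (x * y) ^ i))) \<longlonglongrightarrow> theta x y"
    by (rule jacobi_triple_tendsto[OF assms])
  show "(\<lambda>N. qpoch (x * y) N * (\<Prod>i<N. (1 + x * (x * y) ^ i) * (1 + y * (x * y) ^ i))) \<longlonglongrightarrow> theta y x"
    using jacobi_triple_tendsto[OF assms(2,1)]
    by (simp only: mult.commute[of y x] mult.commute[of "1 + y * _" "1 + x * _"])
qed

lemma theta_eq_limit:
  assumes "x $ 0 = 0" "y $ 0 = 0" "F \<longlonglongrightarrow> a" "G \<longlonglongrightarrow> b"
    and "\<And>N. qpoch (x * y) N * (\<Prod>i<N. (1 + x * (x * y) ^ i) * (1 + y * (x * y) ^ i)) * F N = G N"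
  shows "theta x y * a = b"
  using tendsto_mult_fps[OF jacobi_triple_tendsto[OF assms(1,2)] assms(3)] assms(4)
  unfolding assms(5) by (rule LIMSEQ_unique)

section \<open>Product formulas for four theta series\<close>

lemma qpoch_mult_blocks: "qpoch p (c * N) = (\<Prod>i<N. \<Prod>j<c. 1 - p ^ (c * i + Suc j))"
proof (induction N)
  case (Suc N)
  have "qpoch p (n + c) = qpoch p n * (\<Prod>j<c. 1 - p ^ (n + Suc j))" for n
    by (induction c) (simp_all add: qpoch_Suc mult_ac)
  from this[of "c * N"] Suc show ?case
    by (simp add: add.commute)
qed simp

context
  fixes q :: "'a :: field fps"
  assumes q: "q $ 0 = 0"
begin

lemma qpoch_mult_index_tendsto: "m > 0 \<Longrightarrow> c > 0 \<Longrightarrow> (\<lambda>N. qpoch (q ^ m) (c * N)) \<longlonglongrightarrow> qpoch_inf (q ^ m)"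
  using q by (intro LIMSEQ_mult_index qpoch_tendsto) simp_all

text \<open>With u = q^i each block is a polynomial in u and q, so an equality of finite products
  follows from one polynomial identity per block.\<close>

lemma qpoch_power_blocks:
  "qpoch (q ^ m) (c * N) = (\<Prod>i<N. \<Prod>j<c. 1 - (q ^ i) ^ (c * m) * q ^ (m * Suc j))"
  unfolding qpoch_mult_blocks
  by (intro prod.cong refl arg_cong2[of _ _ _ _ "(-)"])
     (simp add: algebra_simps flip: power_mult power_add)

lemma theta_product_block:
  assumes "x * y = q ^ m"
  shows "qpoch (x * y) N * (\<Prod>i<N. (1 + x * (x * y) ^ i) * (1 + y * (x * y) ^ i)) =
         (\<Prod>i<N. (1 - (q ^ i) ^ m * q ^ m) * ((1 + x * (q ^ i) ^ m) * (1 + y * (q ^ i) ^ m)))"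
  using qpoch_power_blocks[of m 1 N]
  by (simp add: assms prod.distrib mult.commute[of m] flip: power_mult)

text \<open>Gauss's product for the series with terms (-1)^k q^(k^2).\<close>

lemma theta_phi_product:
  "theta (- q) (- q) * qpoch_inf (q ^ 2) = qpoch_inf (q ^ 1) ^ 2"
proof (rule theta_eq_limit)
  \<comment> \<open>The lengths N and 2N are chosen so that the i-th blocks on both sides are equal;
    the three product formulas below choose theirs likewise.\<close>
  show "(\<lambda>N. qpoch (q ^ 2) (1 * N)) \<longlonglongrightarrow> qpoch_inf (q ^ 2)"
       "(\<lambda>N. qpoch (q ^ 1) (2 * N) ^ 2) \<longlonglongrightarrow> qpoch_inf (q ^ 1) ^ 2"
    by (intro tendsto_power_fps qpoch_mult_index_tendsto; simp)+
  have xy: "- q * - q = q ^ 2"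
    by (simp add: power2_eq_square)
  show "qpoch (- q * - q) N * (\<Prod>i<N. (1 + - q * (- q * - q) ^ i) * (1 + - q * (- q * - q) ^ i)) *
          qpoch (q ^ 2) (1 * N) = qpoch (q ^ 1) (2 * N) ^ 2" for N
    unfolding theta_product_block[OF xy] qpoch_power_blocks prod_power_distrib prod.distrib[symmetric]
    by (intro prod.cong refl, simp add: lessThan_nat_numeral lessThan_Suc, algebra)
qed (use q in simp_all)

text \<open>The redundant factor \<open>E(q\<^sup>4)\<close> makes the two sides agree factor by factor at every finite stage.\<close>

lemma theta_psi_product:
  "theta q (q ^ 3) * (qpoch_inf (q ^ 1) * qpoch_inf (q ^ 4)) = qpoch_inf (q ^ 2) ^ 2 * qpoch_inf (q ^ 4)"
proof (rule theta_eq_limit)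
  show "(\<lambda>N. qpoch (q ^ 1) (4 * N) * qpoch (q ^ 4) (2 * N)) \<longlonglongrightarrow> qpoch_inf (q ^ 1) * qpoch_inf (q ^ 4)"
    by (intro tendsto_mult_fps qpoch_mult_index_tendsto; simp)+
  show "(\<lambda>N. qpoch (q ^ 2) (2 * N) * qpoch (q ^ 2) (4 * N) * qpoch (q ^ 4) (1 * N))
          \<longlonglongrightarrow> qpoch_inf (q ^ 2) ^ 2 * qpoch_inf (q ^ 4)"
    unfolding power2_eq_square[of "qpoch_inf _"]
    by (intro tendsto_mult_fps qpoch_mult_index_tendsto; simp)+
  have xy: "q * q ^ 3 = q ^ 4"
    by (simp add: eval_nat_numeral)
  show "qpoch (q * q ^ 3) N * (\<Prod>i<N. (1 + q * (q * q ^ 3) ^ i) * (1 + q ^ 3 * (q * q ^ 3) ^ i)) *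
          (qpoch (q ^ 1) (4 * N) * qpoch (q ^ 4) (2 * N)) =
        qpoch (q ^ 2) (2 * N) * qpoch (q ^ 2) (4 * N) * qpoch (q ^ 4) (1 * N)" for N
    unfolding theta_product_block[OF xy] qpoch_power_blocks prod_power_distrib prod.distrib[symmetric]
    by (intro prod.cong refl, simp add: lessThan_nat_numeral lessThan_Suc, algebra)
qed (use q in simp_all)

text \<open>At q^3 this series is the component of psi with exponents 0 mod 3.\<close>

lemma theta_1_2_product:
  "theta q (q ^ 2) * (qpoch_inf (q ^ 1) * qpoch_inf (q ^ 6)) = qpoch_inf (q ^ 2) * qpoch_inf (q ^ 3) ^ 2"
proof (rule theta_eq_limit)
  show "(\<lambda>N. qpoch (q ^ 1) (3 * N) * qpoch (q ^ 6) (1 * N)) \<longlonglongrightarrow> qpoch_inf (q ^ 1) * qpoch_inf (q ^ 6)"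
       "(\<lambda>N. qpoch (q ^ 2) (3 * N) * qpoch (q ^ 3) (1 * N) ^ 2) \<longlonglongrightarrow> qpoch_inf (q ^ 2) * qpoch_inf (q ^ 3) ^ 2"
    by (intro tendsto_mult_fps tendsto_power_fps qpoch_mult_index_tendsto; simp)+
  have xy: "q * q ^ 2 = q ^ 3"
    by (simp add: eval_nat_numeral)
  show "qpoch (q * q ^ 2) N * (\<Prod>i<N. (1 + q * (q * q ^ 2) ^ i) * (1 + q ^ 2 * (q * q ^ 2) ^ i)) *
          (qpoch (q ^ 1) (3 * N) * qpoch (q ^ 6) (1 * N)) =
        qpoch (q ^ 2) (3 * N) * qpoch (q ^ 3) (1 * N) ^ 2" for N
    unfolding theta_product_block[OF xy] qpoch_power_blocks prod_power_distrib prod.distrib[symmetric]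
    by (intro prod.cong refl, simp add: lessThan_nat_numeral lessThan_Suc, algebra)
qed (use q in simp_all)

text \<open>At q^3 and times -2q, this series is the component of E(q)^2 / E(q^2) with exponents 1
  mod 3.\<close>

lemma theta_1_5_product:
  "theta (- q) (- (q ^ 5)) * (qpoch_inf (q ^ 2) * qpoch_inf (q ^ 3)) = qpoch_inf (q ^ 1) * qpoch_inf (q ^ 6) ^ 2"
proof (rule theta_eq_limit)
  show "(\<lambda>N. qpoch (q ^ 2) (3 * N) * qpoch (q ^ 3) (2 * N)) \<longlonglongrightarrow> qpoch_inf (q ^ 2) * qpoch_inf (q ^ 3)"
       "(\<lambda>N. qpoch (q ^ 1) (6 * N) * qpoch (q ^ 6) (1 * N) ^ 2) \<longlonglongrightarrow> qpoch_inf (q ^ 1) * qpoch_inf (q ^ 6) ^ 2"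
    by (intro tendsto_mult_fps tendsto_power_fps qpoch_mult_index_tendsto; simp)+
  have xy: "- q * - (q ^ 5) = q ^ 6"
    by (simp add: eval_nat_numeral)
  show "qpoch (- q * - (q ^ 5)) N * (\<Prod>i<N. (1 + - q * (- q * - (q ^ 5)) ^ i) * (1 + - (q ^ 5) * (- q * - (q ^ 5)) ^ i)) *
          (qpoch (q ^ 2) (3 * N) * qpoch (q ^ 3) (2 * N)) =
        qpoch (q ^ 1) (6 * N) * qpoch (q ^ 6) (1 * N) ^ 2" for N
    unfolding theta_product_block[OF xy] qpoch_power_blocks prod_power_distrib prod.distrib[symmetric]
    by (intro prod.cong refl, simp add: lessThan_nat_numeral lessThan_Suc, algebra)
qed (use q in simp_all)

end

subsection \<open>Dissection of theta series\<close>

text \<open>Residues are taken in {-1, 0, 1}, so that the symmetric range splits into three copies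
  of -N..N.\<close>

lemma sum_int_triples:
  fixes f :: "int \<Rightarrow> 'a :: comm_monoid_add"
  shows "(\<Sum>k\<in>{-int (3*N+1)..int (3*N+1)}. f k) =
         (\<Sum>m\<in>{-int N..int N}. f (3*m)) + (\<Sum>m\<in>{-int N..int N}. f (3*m + 1)) + (\<Sum>m\<in>{-int N..int N}. f (3*m - 1))"
proof -
  have div: "3 * ((a + 1) div 3) + ((a + 1) mod 3 - 1) = a" for a :: int
    by presburger
  have "(\<Sum>k\<in>{-int (3*N+1)..int (3*N+1)}. f k) =
        (\<Sum>(m, r)\<in>{-int N..int N} \<times> {0, 1, -1}. f (3*m + r))"
    by (rule sum.reindex_bij_witness[where i = "\<lambda>(m, r). 3*m + r"
          and j = "\<lambda>k. ((k + 1) div 3, (k + 1) mod 3 - 1)"]) (auto simp: div)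
  also have "\<dots> = (\<Sum>m\<in>{-int N..int N}. f (3*m) + (f (3*m + 1) + f (3*m - 1)))"
    by (simp flip: sum.cartesian_product)
  finally show ?thesis by (simp add: sum.distrib add.assoc)
qed

lemma sum_int_pairs:
  fixes f :: "int \<Rightarrow> 'a :: comm_monoid_add"
  shows "(\<Sum>k\<in>{-int (2*N)..int (2*N+1)}. f k) =
         (\<Sum>m\<in>{-int N..int N}. f (2*m)) + (\<Sum>m\<in>{-int N..int N}. f (2*m + 1))"
proof -
  have "(\<Sum>k\<in>{-int (2*N)..int (2*N+1)}. f k) = (\<Sum>(m, r)\<in>{-int N..int N} \<times> {0, 1}. f (2*m + r))"
    by (rule sum.reindex_bij_witness[where i = "\<lambda>(m, r). 2*m + r" and j = "\<lambda>k. (k div 2, k mod 2)"]) auto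
  also have "\<dots> = (\<Sum>m\<in>{-int N..int N}. f (2*m) + f (2*m + 1))"
    by (simp flip: sum.cartesian_product)
  finally show ?thesis by (simp add: sum.distrib)
qed

lemma theta_term_powers: "theta_term (r ^ a) (r ^ b) k = r ^ (a * tri k + b * tri (k - 1))"
  by (simp add: theta_term_def power_add flip: power_mult)

lemma theta_term_powers': "theta_term r (r ^ b) k = r ^ (tri k + b * tri (k - 1))"
  using theta_term_powers[of r 1 b k] by simp

text \<open>The exponents are k^2. The classes k = 3m + 1 and k = 3m - 1 give equal series by the
  symmetry of theta, whence the factor 2.\<close>

lemma theta_phi_dissection:
  fixes r :: "'a :: field fps"
  assumes r: "r $ 0 = 0"
  shows "theta r r = theta (r ^ 9) (r ^ 9) + 2 * r * theta (r ^ 3) (r ^ 15)"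
proof (rule LIMSEQ_unique)
  show "(\<lambda>N. \<Sum>k\<in>{-int (3*N+1)..int (3*N+1)}. theta_term r r k) \<longlonglongrightarrow> theta r r"
    by (rule theta_sum_tendsto) (use r in auto)
  have 0: "theta_term r r (3 * m) = theta_term (r ^ 9) (r ^ 9) m" for m
  proof -
    have "int (tri (3*m) + 1 * tri (3*m - 1)) = int (9 * tri m + 9 * tri (m - 1))"
      using int_tri[of "3*m"] int_tri[of "3*m - 1"] int_tri[of m] int_tri[of "m - 1"]
      by (simp add: algebra_simps)
    thus ?thesis
      using theta_term_powers'[of r 1 "3*m"] by (simp only: of_nat_eq_iff theta_term_powers power_one_right)
  qed
  have 1: "theta_term r r (3 * m + 1) = r * theta_term (r ^ 15) (r ^ 3) m" for m
  proof -
    have "int (tri (3*m + 1) + 1 * tri (3*m + 1 - 1)) = int (Suc (15 * tri m + 3 * tri (m - 1)))"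
      using int_tri[of "3*m"] int_tri[of "3*m + 1"] int_tri[of m] int_tri[of "m - 1"]
      by (simp add: algebra_simps)
    thus ?thesis
      using theta_term_powers'[of r 1 "3*m + 1"]
      by (simp only: of_nat_eq_iff theta_term_powers power_one_right power_Suc)
  qed
  have 2: "theta_term r r (3 * m - 1) = r * theta_term (r ^ 3) (r ^ 15) m" for m
  proof -
    have "int (tri (3*m - 1) + 1 * tri (3*m - 1 - 1)) = int (Suc (3 * tri m + 15 * tri (m - 1)))"
      using int_tri[of "3*m - 1"] int_tri[of "3*m - 1 - 1"] int_tri[of m] int_tri[of "m - 1"]
      by (simp add: algebra_simps)
    thus ?thesis
      using theta_term_powers'[of r 1 "3*m - 1"]
      by (simp only: of_nat_eq_iff theta_term_powers power_one_right power_Suc)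
  qed
  have "(\<lambda>N. \<Sum>k\<in>{-int (3*N+1)..int (3*N+1)}. theta_term r r k) \<longlonglongrightarrow>
      theta (r ^ 9) (r ^ 9) + r * theta (r ^ 15) (r ^ 3) + r * theta (r ^ 3) (r ^ 15)"
    unfolding sum_int_triples 0 1 2 sum_distrib_left[symmetric]
    by (intro tendsto_add_fps tendsto_mult_fps tendsto_const theta_sum_tendsto) (use r in simp_all)
  thus "(\<lambda>N. \<Sum>k\<in>{-int (3*N+1)..int (3*N+1)}. theta_term r r k) \<longlonglongrightarrow>
      theta (r ^ 9) (r ^ 9) + 2 * r * theta (r ^ 3) (r ^ 15)"
    using r by (simp add: theta_commute[of "r ^ 15" "r ^ 3"] add.assoc mult.assoc flip: mult_2)
qed

text \<open>The exponents are 2k^2 - k. The class k = 3m + 1 gives q psi(q^9); the classes 3m and 3m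
  - 1 supply the even and the odd indices of the single series
  \<open>theta (q ^ 3) (q ^ 6)\<close>.\<close>

lemma theta_psi_dissection:
  fixes q :: "'a :: field fps"
  assumes q: "q $ 0 = 0"
  shows "theta q (q ^ 3) = theta (q ^ 3) (q ^ 6) + q * theta (q ^ 9) (q ^ 27)"
proof (rule LIMSEQ_unique)
  let ?B = "\<lambda>N. {-int N..int N}"
  show "(\<lambda>N. \<Sum>k\<in>{-int (3*N+1)..int (3*N+1)}. theta_term q (q ^ 3) k) \<longlonglongrightarrow> theta q (q ^ 3)"
    by (rule theta_sum_tendsto) (use q in auto)
  have 0: "theta_term q (q ^ 3) (3 * m) = theta_term (q ^ 3) (q ^ 6) (2 * m)" for m
  proof -
    have "int (tri (3*m) + 3 * tri (3*m - 1)) = int (3 * tri (2*m) + 6 * tri (2*m - 1))"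
      using int_tri[of "3*m"] int_tri[of "3*m - 1"] int_tri[of "2*m"] int_tri[of "2*m - 1"]
      by (simp add: algebra_simps)
    thus ?thesis
      by (simp only: of_nat_eq_iff theta_term_powers theta_term_powers')
  qed
  have 1: "theta_term q (q ^ 3) (3 * m + 1) = q * theta_term (q ^ 27) (q ^ 9) m" for m
  proof -
    have "int (tri (3*m + 1) + 3 * tri (3*m + 1 - 1)) = int (Suc (27 * tri m + 9 * tri (m - 1)))"
      using int_tri[of "3*m"] int_tri[of "3*m + 1"] int_tri[of m] int_tri[of "m - 1"]
      by (simp add: algebra_simps)
    thus ?thesis
      by (simp only: of_nat_eq_iff theta_term_powers theta_term_powers' power_Suc)
  qed
  \<comment> \<open>The odd indices are traversed in descending order, hence the sign;
    \<open>neg\<close> reverses the sum afterwards.\<close>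
  have 2: "theta_term q (q ^ 3) (3 * m - 1) = theta_term (q ^ 3) (q ^ 6) (2 * (- m) + 1)" for m
  proof -
    have "int (tri (3*m - 1) + 3 * tri (3*m - 1 - 1)) = int (3 * tri (2 * (- m) + 1) + 6 * tri (2 * (- m) + 1 - 1))"
      using int_tri[of "3*m - 1"] int_tri[of "3*m - 1 - 1"] int_tri[of "2*(-m) + 1"] int_tri[of "2*(-m)+1 - 1"]
      by (simp add: algebra_simps)
    thus ?thesis
      by (simp only: of_nat_eq_iff theta_term_powers theta_term_powers')
  qed
  have neg: "(\<Sum>m\<in>?B N. f (- m)) = (\<Sum>m\<in>?B N. f m)" for f :: "int \<Rightarrow> 'a fps" and N
    by (rule sum.reindex_bij_witness[where i = uminus and j = uminus]) auto
  have "(\<Sum>k\<in>{-int (3*N+1)..int (3*N+1)}. theta_term q (q ^ 3) k) =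
        (\<Sum>k\<in>{-int (2*N)..int (2*N+1)}. theta_term (q ^ 3) (q ^ 6) k) +
        q * (\<Sum>m\<in>?B N. theta_term (q ^ 27) (q ^ 9) m)" for N
    unfolding sum_int_triples sum_int_pairs 0 1 2 sum_distrib_left[symmetric]
      neg[of "\<lambda>m. theta_term _ _ (2 * m + 1)"]
    by (simp add: add_ac)
  moreover have "(\<lambda>N. (\<Sum>k\<in>{-int (2*N)..int (2*N+1)}. theta_term (q ^ 3) (q ^ 6) k) +
        q * (\<Sum>m\<in>?B N. theta_term (q ^ 27) (q ^ 9) m)) \<longlonglongrightarrow> theta (q ^ 3) (q ^ 6) + q * theta (q ^ 27) (q ^ 9)"
    by (intro tendsto_add_fps tendsto_mult_fps tendsto_const theta_sum_tendsto) (use q in auto)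
  ultimately show "(\<lambda>N. \<Sum>k\<in>{-int (3*N+1)..int (3*N+1)}. theta_term q (q ^ 3) k) \<longlonglongrightarrow>
      theta (q ^ 3) (q ^ 6) + q * theta (q ^ 9) (q ^ 27)"
    using q by (simp add: theta_commute[of "q ^ 9" "q ^ 27"])
qed

subsection \<open>The norm over third roots of unity\<close>

definition trisect :: "nat \<Rightarrow> 'a :: comm_ring_1 fps \<Rightarrow> 'a fps" where
  "trisect r f = Abs_fps (\<lambda>n. f $ (3 * n + r))"

text \<open>Reassembles a series from its residue classes, so that norm identities become polynomial
  identities in a, b, c.\<close>

definition tricomb :: "'a :: comm_ring_1 fps \<Rightarrow> 'a fps \<Rightarrow> 'a fps \<Rightarrow> 'a fps" where
  "tricomb a b c = (a oo fps_X ^ 3) + fps_X * (b oo fps_X ^ 3) + fps_X ^ 2 * (c oo fps_X ^ 3)"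

lemma tricomb_nth:
  "tricomb a b c $ (3 * n) = a $ n"
  "tricomb a b c $ (3 * n + 1) = b $ n"
  "tricomb a b c $ (3 * n + 2) = c $ n"
proof -
  have 1: "\<not> 3 dvd 3 * n - Suc 0" if "n > 0"
    using that by presburger
  have 2: "\<not> 3 dvd 3 * n - 2" if "n > 0"
    using that by presburger
  have 3: "\<not> 3 dvd Suc (3 * n)" "\<not> 3 dvd Suc (Suc (3 * n))" by presburger+
  show "tricomb a b c $ (3 * n) = a $ n"
    unfolding tricomb_def using 1 2
    by (auto simp: fps_nth_compose_X_power fps_X_power_mult_nth)
  show "tricomb a b c $ (3 * n + 1) = b $ n"
    unfolding tricomb_def using 1 3
    by (auto simp: fps_nth_compose_X_power fps_X_power_mult_nth)
  show "tricomb a b c $ (3 * n + 2) = c $ n"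
    unfolding tricomb_def using 3
    by (auto simp: fps_nth_compose_X_power fps_X_power_mult_nth)
qed

lemma trisect_tricomb [simp]:
  "trisect 0 (tricomb a b c) = a" "trisect 1 (tricomb a b c) = b" "trisect (Suc 0) (tricomb a b c) = b"
  "trisect 2 (tricomb a b c) = c"
  using tricomb_nth[of a b c] by (simp_all add: trisect_def fps_eq_iff)

lemma tricomb_trisect: "tricomb (trisect 0 f) (trisect 1 f) (trisect 2 f) = f"
proof (rule fps_ext)
  fix n :: nat
  have "\<exists>k. n = 3 * k \<or> n = 3 * k + 1 \<or> n = 3 * k + 2"
    by presburger
  then obtain k where "n = 3 * k \<or> n = 3 * k + 1 \<or> n = 3 * k + 2" ..
  thus "tricomb (trisect 0 f) (trisect 1 f) (trisect 2 f) $ n = f $ n"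
    using tricomb_nth[of "trisect 0 f" "trisect 1 f" "trisect 2 f" k] by (auto simp: trisect_def)
qed

lemma tricomb_mult:
  fixes a b c :: "'a :: idom fps"
  shows "tricomb a b c * tricomb a' b' c' =
    tricomb (a * a' + fps_X * (b * c' + c * b')) (a * b' + b * a' + fps_X * (c * c')) (a * c' + b * b' + c * a')"
proof -
  have X: "(fps_X * f) oo fps_X ^ 3 = fps_X ^ 3 * (f oo fps_X ^ 3)" for f :: "'a fps"
    by (simp add: fps_compose_mult_distrib fps_X_fps_compose_startby0)
  show ?thesis
    unfolding tricomb_def fps_compose_add_distrib X
    by (simp add: fps_compose_mult_distrib fps_compose_add_distrib) algebra
qed

text \<open>This is \<open>f(q) f(\<omega>q) f(\<omega>\<^sup>2q)\<close> for a primitive third root of unity \<open>\<omega>\<close>, with \<open>q\<^sup>3\<close> replaced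
  by \<open>q\<close>; expressing it through the trisection keeps the coefficients rational.\<close>
definition trinorm :: "'a :: comm_ring_1 fps \<Rightarrow> 'a fps" where
  "trinorm f = trisect 0 f ^ 3 + fps_X * trisect 1 f ^ 3 + fps_X ^ 2 * trisect 2 f ^ 3
     + (- 3 * fps_X) * (trisect 0 f * trisect 1 f * trisect 2 f)"

lemma trinorm_tricomb:
  "trinorm (tricomb a b c) = a ^ 3 + fps_X * b ^ 3 + fps_X ^ 2 * c ^ 3 + (- 3 * fps_X) * (a * b * c)"
  by (simp add: trinorm_def)

text \<open>The norm form a^3 + q b^3 + q^2 c^3 - 3q abc is multiplicative under the product rule
  \<open>tricomb_mult\<close>, by a polynomial identity.\<close>

lemma trinorm_mult: "trinorm (f * g) = trinorm f * trinorm (g :: 'a :: idom fps)"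
proof -
  have "trinorm (tricomb a b c * tricomb a' b' c') = trinorm (tricomb a b c) * trinorm (tricomb a' b' c')"
    for a b c a' b' c' :: "'a fps"
    unfolding tricomb_mult trinorm_tricomb by algebra
  thus ?thesis by (metis tricomb_trisect)
qed

lemma trinorm_1 [simp]: "trinorm 1 = (1 :: 'a :: idom fps)"
proof -
  have "1 = tricomb 1 0 (0 :: 'a fps)" by (simp add: tricomb_def)
  thus ?thesis by (metis trinorm_tricomb add.right_neutral mult_zero_right power_one zero_power zero_less_numeral)
qed

lemma trinorm_power: "trinorm (f ^ n) = trinorm (f :: 'a :: idom fps) ^ n"
  by (induction n) (simp_all add: trinorm_mult)

lemma trinorm_prod: "trinorm (\<Prod>i\<in>A. f i) = (\<Prod>i\<in>A. trinorm (f i :: 'a :: idom fps))"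
  by (induction A rule: infinite_finite_induct) (simp_all add: trinorm_mult)

lemma trinorm_tendsto:
  assumes "(f \<longlongrightarrow> L) F"
  shows "((\<lambda>x. trinorm (f x)) \<longlongrightarrow> trinorm L) F"
proof -
  have "((\<lambda>x. trisect r (f x)) \<longlongrightarrow> trisect r L) F" for r
    using assms by (simp add: tendsto_fps_iff trisect_def)
  thus ?thesis
    unfolding trinorm_def
    by (intro tendsto_add_fps tendsto_mult_fps tendsto_power_fps tendsto_const)
qed

text \<open>If 3 divides the exponent, the three conjugates coincide. Otherwise they multiply to 1 -
  q^(3k), which becomes 1 - q^k when q^3 is replaced by q.\<close>

lemma trinorm_1_minus_X_power:
  "trinorm (1 - fps_X ^ (3 * j)) = (1 - fps_X ^ j :: 'a :: idom fps) ^ 3"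
  "\<not> 3 dvd k \<Longrightarrow> trinorm (1 - fps_X ^ k) = (1 - fps_X ^ k :: 'a :: idom fps)"
proof -
  have X: "fps_X ^ n oo fps_X ^ 3 = (fps_X ^ (3 * n) :: 'a fps)" for n
    by (simp add: fps_compose_power[symmetric] fps_X_fps_compose_startby0 power_mult)
  have 0: "1 - fps_X ^ (3 * j) = tricomb (1 - fps_X ^ j) 0 (0 :: 'a fps)" for j
    by (simp add: tricomb_def fps_compose_sub_distrib X)
  have 1: "1 - fps_X ^ (3 * j + 1) = tricomb 1 (- (fps_X ^ j)) (0 :: 'a fps)" for j
    by (simp add: tricomb_def fps_compose_uminus X)
  have 2: "1 - fps_X ^ (3 * j + 2) = tricomb 1 0 (- (fps_X ^ j) :: 'a fps)" for j
    by (simp add: tricomb_def fps_compose_uminus X power2_eq_square)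
  show "trinorm (1 - fps_X ^ (3 * j)) = (1 - fps_X ^ j :: 'a fps) ^ 3"
    unfolding 0 trinorm_tricomb by simp
  assume "\<not> 3 dvd k"
  hence "\<exists>j. k = 3 * j + 1 \<or> k = 3 * j + 2"
    by presburger
  then obtain j where "k = 3 * j + 1 \<or> k = 3 * j + 2" ..
  moreover have "trinorm (1 - fps_X ^ (3 * j + 1)) = 1 + fps_X * (- (fps_X ^ j) :: 'a fps) ^ 3"
    unfolding 1 trinorm_tricomb by simp
  moreover have "trinorm (1 - fps_X ^ (3 * j + 2)) = 1 + fps_X ^ 2 * (- (fps_X ^ j) :: 'a fps) ^ 3"
    unfolding 2 trinorm_tricomb by simp
  ultimately show "trinorm (1 - fps_X ^ k) = (1 - fps_X ^ k :: 'a fps)"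
    by (auto simp: power_add power2_eq_square mult_ac simp flip: power_mult)
qed

text \<open>Factors whose index is divisible by 3 contribute E(q^m)^3, the remaining ones E(q^m) /
  E(q^(3m)).\<close>

lemma trinorm_qpoch_inf:
  assumes m: "\<not> 3 dvd m"
  shows "trinorm (qpoch_inf (fps_X ^ m)) * qpoch_inf (fps_X ^ (3 * m)) = qpoch_inf (fps_X ^ m :: 'a :: field fps) ^ 4"
proof (rule LIMSEQ_unique)
  have [simp]: "m > 0" using m by (cases m) auto
  have m': "\<not> 3 dvd m * (3 * i + 1)" "\<not> 3 dvd m * (3 * i + 2)" for i
  proof -
    have "\<not> 3 dvd 3 * n + m" "\<not> 3 dvd 3 * n + 2 * m" for n
      using m by presburger+
    from this[of "m * i"] show "\<not> 3 dvd m * (3 * i + 1)" "\<not> 3 dvd m * (3 * i + 2)"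
      by (simp_all add: algebra_simps)
  qed
  have eq: "trinorm (qpoch (fps_X ^ m) (3 * N)) * qpoch (fps_X ^ (3 * m)) (1 * N) =
        qpoch (fps_X ^ m) (3 * N) * qpoch (fps_X ^ m :: 'a fps) (1 * N) ^ 3" for N
    unfolding qpoch_mult_blocks trinorm_prod prod_power_distrib prod.distrib[symmetric]
  proof (rule prod.cong[OF refl])
    fix i
    have t: "trinorm (1 - (fps_X ^ m) ^ (3 * i + Suc 0)) = (1 - (fps_X ^ m) ^ (3 * i + Suc 0) :: 'a fps)"
      "trinorm (1 - (fps_X ^ m) ^ (3 * i + Suc 1)) = (1 - (fps_X ^ m) ^ (3 * i + Suc 1) :: 'a fps)"
      "trinorm (1 - (fps_X ^ m) ^ (3 * i + Suc 2)) = (1 - (fps_X ^ m) ^ (1 * i + Suc 0) :: 'a fps) ^ 3"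
      using trinorm_1_minus_X_power(2)[OF m'(1)[of i], where ?'a = 'a]
        trinorm_1_minus_X_power(2)[OF m'(2)[of i], where ?'a = 'a]
        trinorm_1_minus_X_power(1)[of "m * (i + 1)", where ?'a = 'a]
      by (simp_all only: power_mult[symmetric]) (simp_all add: algebra_simps del: power_Suc)
    have s: "(fps_X ^ (3 * m)) ^ (1 * i + Suc 0) = ((fps_X ^ m) ^ (3 * i + Suc 2) :: 'a fps)"
      by (simp only: power_mult[symmetric], rule arg_cong[of _ _ "(^) fps_X"]) (simp add: algebra_simps)
    have prod: "(\<Prod>j<3. g j) = g 0 * g 1 * g 2" "(\<Prod>j<1. g j) = g 0" for g :: "nat \<Rightarrow> 'a fps"
      by (simp_all add: eval_nat_numeral)
    show "(\<Prod>j<3. trinorm (1 - (fps_X ^ m) ^ (3 * i + Suc j))) * (\<Prod>j<1. 1 - (fps_X ^ (3 * m)) ^ (1 * i + Suc j)) =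
      (\<Prod>j<3. 1 - (fps_X ^ m) ^ (3 * i + Suc j)) * (\<Prod>j<1. (1 - (fps_X ^ m) ^ (1 * i + Suc j) :: 'a fps) ^ 3)"
      unfolding prod t s by (simp only: mult_ac)
  qed
  note lim = qpoch_mult_index_tendsto[of "fps_X :: 'a fps"]
  show "(\<lambda>N. trinorm (qpoch (fps_X ^ m :: 'a fps) (3 * N)) * qpoch (fps_X ^ (3 * m)) (1 * N))
    \<longlonglongrightarrow> trinorm (qpoch_inf (fps_X ^ m)) * qpoch_inf (fps_X ^ (3 * m))"
    by (intro tendsto_mult_fps trinorm_tendsto lim) simp_all
  have "(\<lambda>N. qpoch (fps_X ^ m :: 'a fps) (3 * N) * qpoch (fps_X ^ m) (1 * N) ^ 3)
    \<longlonglongrightarrow> qpoch_inf (fps_X ^ m) * qpoch_inf (fps_X ^ m) ^ 3"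
    by (intro tendsto_mult_fps tendsto_power_fps lim) simp_all
  thus "(\<lambda>N. trinorm (qpoch (fps_X ^ m :: 'a fps) (3 * N)) * qpoch (fps_X ^ (3 * m)) (1 * N))
    \<longlonglongrightarrow> qpoch_inf (fps_X ^ m) ^ 4"
    unfolding eq by (simp add: eval_nat_numeral)
qed

subsection \<open>Dissections of the eta quotients\<close>

lemma qpoch_inf_X_power_compose_cube:
  assumes "m > 0"
  shows "qpoch_inf (fps_X ^ m) oo fps_X ^ 3 = qpoch_inf (fps_X ^ (3 * m) :: 'a :: field fps)"
proof -
  have "qpoch_inf (fps_X ^ m) oo fps_X ^ 3 = (qpoch_inf fps_X oo fps_X ^ m) oo (fps_X ^ 3 :: 'a fps)"
    using assms by (simp add: qpoch_inf_compose_X_power)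
  also have "\<dots> = qpoch_inf fps_X oo fps_X ^ (3 * m)"
    using assms by (auto simp: fps_eq_iff fps_nth_compose_X_power dvd_div_iff_mult div_mult2_eq mult.commute
        dest: dvd_mult_left dvd_mult_right)
  finally show ?thesis using assms by (simp add: qpoch_inf_compose_X_power)
qed

lemma Eq_nonzero [simp]: "m > 0 \<Longrightarrow> Eq m \<noteq> 0"
  by (simp add: Eq_conv_qpoch_inf)

lemma Eq_compose_cube: "m > 0 \<Longrightarrow> fls_compose_power (Eq m) 3 = Eq (3 * m)"
  by (simp add: Eq_conv_qpoch_inf fls_compose_power_fps_to_fls qpoch_inf_X_power_compose_cube)

abbreviation (input) euler :: "nat \<Rightarrow> rat fps" where "euler m \<equiv> qpoch_inf (fps_X ^ m)"

text \<open>Both rest on f = p(q^3) - 2q w(q^3) with f = E(q)^2 / E(q^2). The norm of f is computed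
  once from these two components and once from its product form by
  \<open>trinorm_qpoch_inf\<close>.\<close>

lemma
  shows phi_dissection:
    "Eq 1 ^ 2 / Eq 2 = Eq 9 ^ 2 / Eq 18 - 2 * fls_X * (Eq 3 * Eq 18 ^ 2 / (Eq 6 * Eq 9))"
    and phi_trinorm:
    "(Eq 3 ^ 2 / Eq 6) ^ 3 - 8 * fls_X * (Eq 1 * Eq 6 ^ 2 / (Eq 2 * Eq 3)) ^ 3 = Eq 1 ^ 8 * Eq 6 / (Eq 2 ^ 4 * Eq 3 ^ 2)"
proof -
  define f p w where "f = theta (- fps_X) (- fps_X :: rat fps)"
    and "p = theta (- (fps_X ^ 3)) (- (fps_X ^ 3) :: rat fps)"
    and "w = theta (- fps_X) (- (fps_X ^ 5) :: rat fps)"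
  define p' w' where "p' = p oo fps_X ^ 3" and "w' = w oo fps_X ^ 3"
  have f: "f * euler 2 = euler 1 ^ 2"
    using theta_phi_product[of fps_X] by (simp add: f_def)
  have p: "p * euler 6 = euler 3 ^ 2"
    using theta_phi_product[of "fps_X ^ 3"] by (simp add: p_def flip: power_mult)
  have w: "w * (euler 2 * euler 3) = euler 1 * euler 6 ^ 2"
    using theta_1_5_product[of fps_X] by (simp add: w_def)
  have comp: "euler m oo fps_X ^ 3 = euler (3 * m)" if "m > 0" for m
    using that by (rule qpoch_inf_X_power_compose_cube)
  have p': "p' * euler 18 = euler 9 ^ 2"
    using arg_cong[OF p, of "\<lambda>g. g oo fps_X ^ 3"]
    by (simp add: p'_def fps_compose_mult_distrib fps_compose_power[symmetric] comp)
  have w': "w' * (euler 6 * euler 9) = euler 3 * euler 18 ^ 2"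
    using arg_cong[OF w, of "\<lambda>g. g oo fps_X ^ 3"] comp[of 1]
    by (simp add: w'_def fps_compose_mult_distrib fps_compose_power[symmetric] comp)
  \<comment> \<open>Equal product forms identify the theta series of the dissection with
    \<open>p'\<close>; the same is then done for \<open>w'\<close>.\<close>
  have "theta ((- fps_X) ^ 9) ((- fps_X) ^ 9) * euler 18 = euler 9 ^ 2"
    using theta_phi_product[of "fps_X ^ 9"] by (simp flip: power_mult)
  hence 1: "theta ((- fps_X) ^ 9) ((- fps_X) ^ 9) = p'"
    using p' by (metis mult_cancel_right qpoch_inf_nonzero)
  have "theta ((- fps_X) ^ 3) ((- fps_X) ^ 15) * (euler 6 * euler 9) = euler 3 * euler 18 ^ 2"
    using theta_1_5_product[of "fps_X ^ 3"] by (simp flip: power_mult)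
  hence 2: "theta ((- fps_X) ^ 3) ((- fps_X) ^ 15) = w'"
    using w' by (metis mult_cancel_right qpoch_inf_nonzero no_zero_divisors)
  have dis: "f = p' - 2 * fps_X * w'"
    using theta_phi_dissection[of "- fps_X :: rat fps"] unfolding 1 2 f_def[symmetric] by simp

  have fls: "fps_to_fls p = Eq 3 ^ 2 / Eq 6" "fps_to_fls p' = Eq 9 ^ 2 / Eq 18"
    "fps_to_fls f = Eq 1 ^ 2 / Eq 2" "fps_to_fls w = Eq 1 * Eq 6 ^ 2 / (Eq 2 * Eq 3)"
    "fps_to_fls w' = Eq 3 * Eq 18 ^ 2 / (Eq 6 * Eq 9)"
    using p p' f w w'
    by (simp_all add: nonzero_eq_divide_eq Eq_conv_qpoch_inf del: power_one_right
        flip: fls_times_fps_to_fls fps_to_fls_power)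
  show "Eq 1 ^ 2 / Eq 2 = Eq 9 ^ 2 / Eq 18 - 2 * fls_X * (Eq 3 * Eq 18 ^ 2 / (Eq 6 * Eq 9))"
    using arg_cong[OF dis, of fps_to_fls] by (simp add: fls_times_fps_to_fls fls)

  have "f = tricomb p (- 2 * w) 0"
    unfolding dis by (simp add: tricomb_def p'_def w'_def fps_compose_uminus fps_compose_mult_distrib)
  hence "trinorm f = p ^ 3 - 8 * fps_X * w ^ 3"
    by (simp add: trinorm_tricomb power_mult_distrib)
  moreover have "trinorm f * trinorm (euler 2) = trinorm (euler 1) ^ 2"
    using arg_cong[OF f, of trinorm] by (simp only: trinorm_mult trinorm_power)
  moreover have "trinorm (euler 1) * euler 3 = euler 1 ^ 4" "trinorm (euler 2) * euler 6 = euler 2 ^ 4"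
    using trinorm_qpoch_inf[of 1, where ?'a = rat] trinorm_qpoch_inf[of 2, where ?'a = rat] by simp_all
  ultimately have "(p ^ 3 - 8 * fps_X * w ^ 3) * (euler 2 ^ 4 * euler 3 ^ 2) = euler 1 ^ 8 * euler 6"
    by algebra
  hence "((Eq 3 ^ 2 / Eq 6) ^ 3 - 8 * fls_X * (Eq 1 * Eq 6 ^ 2 / (Eq 2 * Eq 3)) ^ 3) * (Eq 2 ^ 4 * Eq 3 ^ 2) =
      Eq 1 ^ 8 * Eq 6"
    unfolding fls[symmetric]
    by (simp add: Eq_conv_qpoch_inf del: power_one_right
        flip: fls_times_fps_to_fls fps_to_fls_power fps_to_fls_minus fps_X_to_fls fps_to_fls_numeral)
  thus "(Eq 3 ^ 2 / Eq 6) ^ 3 - 8 * fls_X * (Eq 1 * Eq 6 ^ 2 / (Eq 2 * Eq 3)) ^ 3 = Eq 1 ^ 8 * Eq 6 / (Eq 2 ^ 4 * Eq 3 ^ 2)"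
    by (subst nonzero_eq_divide_eq) simp_all
qed

lemma psi_dissection:
  "Eq 2 ^ 2 / Eq 1 = Eq 6 * Eq 9 ^ 2 / (Eq 3 * Eq 18) + fls_X * (Eq 18 ^ 2 / Eq 9)"
proof -
  define f a b where "f = theta fps_X (fps_X ^ 3 :: rat fps)"
    and "a = theta (fps_X ^ 3) (fps_X ^ 6 :: rat fps)" and "b = theta (fps_X ^ 9) (fps_X ^ 27 :: rat fps)"
  have f: "f * euler 1 = euler 2 ^ 2"
    using theta_psi_product[of "fps_X :: rat fps"] by (simp add: f_def flip: mult.assoc)
  have b: "b * euler 9 = euler 18 ^ 2"
    using theta_psi_product[of "fps_X ^ 9 :: rat fps"] by (simp add: b_def flip: mult.assoc power_mult)
  have a: "a * (euler 3 * euler 18) = euler 6 * euler 9 ^ 2"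
    using theta_1_2_product[of "fps_X ^ 3 :: rat fps"] by (simp add: a_def flip: power_mult)
  have fls: "fps_to_fls f = Eq 2 ^ 2 / Eq 1" "fps_to_fls b = Eq 18 ^ 2 / Eq 9"
    "fps_to_fls a = Eq 6 * Eq 9 ^ 2 / (Eq 3 * Eq 18)"
    using f a b
    by (simp_all add: nonzero_eq_divide_eq Eq_conv_qpoch_inf del: power_one_right
        flip: fls_times_fps_to_fls fps_to_fls_power)
  have "f = a + fps_X * b"
    unfolding f_def a_def b_def by (rule theta_psi_dissection) simp
  from arg_cong[OF this, of fps_to_fls] show ?thesis
    by (simp add: fls_times_fps_to_fls fls)
qed

text \<open>\<open>par\<close> is the series \<open>t\<close> of the introduction, and \<open>par_cube\<close> is \<open>t\<^sup>3\<close> with \<open>q\<^sup>3\<close> replaced by \<open>q\<close>.\<close>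

definition par :: "rat fls" where
  "par = fls_X * (Eq 3 * Eq 18 ^ 3 / (Eq 6 * Eq 9 ^ 3))"

definition par_cube :: "rat fls" where
  "par_cube = fls_X * (Eq 1 * Eq 6 ^ 3 / (Eq 2 * Eq 3 ^ 3)) ^ 3"

lemma par_nonzero: "par \<noteq> 0" "par_cube \<noteq> 0"
  by (simp_all add: par_def par_cube_def)

lemma fls_compose_power_inverse:
  fixes f :: "'a :: field fls"
  assumes "d > 0"
  shows "fls_compose_power (inverse f) d = inverse (fls_compose_power f d)"
proof (cases "f = 0")
  case False
  hence "fls_compose_power f d * fls_compose_power (inverse f) d = 1"
    using assms by (simp flip: fls_compose_power_mult)
  thus ?thesis
    by (rule inverse_unique[symmetric])
qed simp

lemma fls_compose_power_divide:
  "d > 0 \<Longrightarrow> fls_compose_power (f / g :: 'a :: field fls) d = fls_compose_power f d / fls_compose_power g d"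
  by (simp add: divide_inverse fls_compose_power_inverse)

lemma fls_compose_power_numeral:
  "d > 0 \<Longrightarrow> fls_compose_power (numeral n :: 'a :: field fls) d = numeral n"
  by (metis fls_const_numeral fls_compose_power_const_left)

section \<open>The eta quotients as rational functions of \<open>par\<close>\<close>

lemma par_cube_compose_cube: "fls_compose_power par_cube 3 = par ^ 3"
  by (simp add: par_def par_cube_def fls_compose_power_divide Eq_compose_cube power_mult_distrib power_divide
      fls_X_power_conv_shift_1 del: power_one_right)

text \<open>The dissection of phi(q) divided by phi(q^9), where phi(q) = E(q)^2 / E(q^2).\<close>

lemma one_minus_2_par: "1 - 2 * par = Eq 1 ^ 2 * Eq 18 / (Eq 2 * Eq 9 ^ 2)"
proof -
  have "(Eq 9 ^ 2 / Eq 18) * (1 - 2 * par) = Eq 1 ^ 2 / Eq 2"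
    unfolding phi_dissection par_def by (simp add: field_simps eval_nat_numeral)
  thus ?thesis by (simp add: field_simps)
qed

text \<open>With psi(q) = E(q^2)^2 / E(q), the dissection divided by q psi(q^9) gives 1 + 1/t; here
  it is multiplied by t.\<close>

lemma one_plus_par: "1 + par = par * (Eq 2 ^ 2 * Eq 9 / (fls_X * Eq 1 * Eq 18 ^ 2))"
proof -
  have "par * (Eq 2 ^ 2 / Eq 1) * (Eq 9 / (fls_X * Eq 18 ^ 2)) = 1 + par"
    unfolding psi_dissection par_def by (simp add: field_simps eval_nat_numeral)
  thus ?thesis by (simp add: field_simps)
qed

text \<open>Dividing \<open>phi_trinorm\<close> by phi(q^3)^3 turns its right side into phi(q)^4 /
  phi(q^3)^4, which is 1 / X.\<close>

lemma Xs_par_cube: "Xs * (1 - 8 * par_cube) = 1"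
proof -
  have "1 - 8 * par_cube = ((Eq 3 ^ 2 / Eq 6) ^ 3 - 8 * fls_X * (Eq 1 * Eq 6 ^ 2 / (Eq 2 * Eq 3)) ^ 3) / (Eq 3 ^ 2 / Eq 6) ^ 3"
    unfolding par_cube_def by (simp add: field_simps)
  thus ?thesis
    unfolding phi_trinorm Xs_def by (simp add: field_simps, algebra)
qed

lemma Xs_compose_cube: "fls_compose_power Xs 3 * (1 - 8 * par ^ 3) = 1"
  using arg_cong[OF Xs_par_cube, of "\<lambda>f. fls_compose_power f 3"]
  by (simp add: par_cube_compose_cube fls_compose_power_numeral)

lemma xi_conv_par: "xi * (par ^ 2 * (1 - 2 * par)) = (1 + par) ^ 2"
proof -
  have "fls_X_intpow (-2) * fls_X ^ 2 = (1 :: rat fls)"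
    by (simp add: fls_X_power_times_conv_shift)
  hence X: "fls_X_intpow (-2) = 1 / (fls_X ^ 2 :: rat fls)"
    by (simp add: nonzero_eq_divide_eq)
  show ?thesis
    unfolding xi_def X one_minus_2_par one_plus_par
    by (simp add: field_simps eval_nat_numeral)
qed

text \<open>Here 1 - 2t = phi(q) / phi(q^9), and 1 - 8t^3 = 1 / X(q^3) = phi(q^3)^4 /
  phi(q^9)^4.\<close>

lemma Xs_conv_par: "Xs * (1 - 2 * par) ^ 4 = 1 - 8 * par ^ 3"
proof -
  have "fls_compose_power Xs 3 = Eq 6 ^ 4 * Eq 9 ^ 8 / (Eq 3 ^ 8 * Eq 18 ^ 4)"
    unfolding Xs_def by (simp add: fls_compose_power_divide Eq_compose_cube del: power_one_right)
  hence par: "1 - 8 * par ^ 3 = Eq 3 ^ 8 * Eq 18 ^ 4 / (Eq 6 ^ 4 * Eq 9 ^ 8)"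
    using Xs_compose_cube by (simp add: field_simps, algebra)
  show ?thesis
    unfolding par one_minus_2_par Xs_def by (simp add: field_simps)
qed

text \<open>U undoes q -> q^3 and annihilates the exponents 1 and 2 mod 3.\<close>

lemma U3_trisection:
  fixes a b c :: "'a :: field fls"
  shows "U3 (fls_compose_power a 3 + fls_X * fls_compose_power b 3 + fls_X ^ 2 * fls_compose_power c 3) = a"
proof (rule fls_eqI)
  fix n :: int
  have "\<not> 3 dvd 3 * n - 1" "\<not> 3 dvd 3 * n - 2" by presburger+
  thus "fls_nth (U3 (fls_compose_power a 3 + fls_X * fls_compose_power b 3
      + fls_X ^ 2 * fls_compose_power c 3)) n = fls_nth a n"
    by (simp add: U3.rep_eq fls_nth_compose_power fls_X_times_conv_shift fls_X_power_times_conv_shift)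
qed

text \<open>Up to powers of Y = X(q^3), xi X^k is a polynomial in t divided by t^2;
  \<open>a\<close>, \<open>b\<close>, \<open>c\<close> collect its exponents 2, 0, 1 mod 3. The
  division by t^2 moves the part of \<open>a\<close> to 0 mod 3, so it alone survives U, and Y^n
  comes out as X^n.\<close>

lemma U3_xi_Xs_power:
  assumes abc: "(1 + par) ^ 2 * (1 + 2 * par + 4 * par ^ 2) ^ m =
      par ^ 2 * fls_compose_power a 3 + fls_compose_power b 3 + par * fls_compose_power c 3"
    and m: "m = 4 * k + 1" and n: "n = 3 * k + 1"
  shows "U3 (xi * Xs ^ k) = a * Xs ^ n"
proof -
  let ?V = "\<lambda>f. fls_compose_power f 3"
  let ?t = "par" and ?Y = "?V Xs" and ?s = "1 + 2 * par + 4 * par ^ 2"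
  define w where "w = Eq 1 * Eq 6 ^ 3 / (Eq 2 * Eq 3 ^ 3)"
  have t: "?t = fls_X * ?V w"
    by (simp add: w_def par_def fls_compose_power_divide Eq_compose_cube del: power_one_right)
  have Y: "?Y * (1 - 8 * ?t ^ 3) = 1"
    by (rule Xs_compose_cube)
  have s: "(1 - 2 * ?t) * (?s * ?Y) = 1"
    using Y by algebra
  have T: "?V (inverse par_cube) * ?t ^ 3 = 1"
    using par_nonzero by (simp add: fls_compose_power_inverse par_cube_compose_cube)
  have "xi * Xs ^ k * ?t ^ 2 = (1 + ?t) ^ 2 * ?s ^ m * ?Y ^ n"
  proof -
    have "xi * ?t ^ 2 = xi * (?t ^ 2 * (1 - 2 * ?t)) * (?s * ?Y)"
      using s by algebra
    also have "\<dots> = (1 + ?t) ^ 2 * (?s * ?Y)"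
      by (simp only: xi_conv_par)
    finally have 1: "xi * ?t ^ 2 = (1 + ?t) ^ 2 * (?s * ?Y)" .
    \<comment> \<open>Since 1 / (1 - 2t) = s Y, this turns (1 - 8t^3) / (1 - 2t)^4 into Y^(-1) (s
      Y)^4.\<close>
    have "Xs = Xs * (1 - 2 * ?t) ^ 4 * (?s * ?Y) ^ 4"
      using s by algebra
    also have "\<dots> = ?s ^ 4 * ?Y ^ 3"
      unfolding Xs_conv_par using Y by algebra
    finally have 2: "Xs = ?s ^ 4 * ?Y ^ 3" .
    have "xi * Xs ^ k * ?t ^ 2 = (xi * ?t ^ 2) * Xs ^ k"
      by (simp only: mult_ac)
    also have "\<dots> = (1 + ?t) ^ 2 * (?s * ?Y) * (?s ^ 4 * ?Y ^ 3) ^ k"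
      by (simp only: 1 2[symmetric])
    also have "\<dots> = (1 + ?t) ^ 2 * ?s ^ m * ?Y ^ n"
      unfolding m n power_mult_distrib power_mult power_add power_one_right by (simp only: mult_ac)
    finally show ?thesis .
  qed
  also have "\<dots> = (?V a + ?V (w * b * inverse par_cube) * fls_X + fls_X ^ 2 * ?V (w ^ 2 * c * inverse par_cube)) *
      ?Y ^ n * ?t ^ 2"
  proof -
    \<comment> \<open>After division by t^2 the other two parts carry t^(-2) = t * t^(-3) and t^(-1)
      = t^2 * t^(-3), where t^(-3) is \<open>?V (inverse par_cube)\<close>.\<close>
    have bc: "?V (w * b * inverse par_cube) * fls_X = ?t * ?V b * ?V (inverse par_cube)"
         "fls_X ^ 2 * ?V (w ^ 2 * c * inverse par_cube) = ?t ^ 2 * ?V c * ?V (inverse par_cube)"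
      by (simp_all add: t power_mult_distrib mult_ac)
    have "par ^ 2 * ?V a + ?V b + par * ?V c =
        (?V a + ?t * ?V b * ?V (inverse par_cube) + ?t ^ 2 * ?V c * ?V (inverse par_cube)) * ?t ^ 2"
      using T by algebra
    thus ?thesis
      unfolding abc bc by (simp only: mult_ac)
  qed
  finally have "xi * Xs ^ k = (?V a + ?V (w * b * inverse par_cube) * fls_X + fls_X ^ 2 * ?V (w ^ 2 * c * inverse par_cube)) *
      ?Y ^ n"
    using par_nonzero(1) by simp
  also have "\<dots> = ?V (a * Xs ^ n) + fls_X * ?V (w * b * inverse par_cube * Xs ^ n)
      + fls_X ^ 2 * ?V (w ^ 2 * c * inverse par_cube * Xs ^ n)"
    by (simp add: algebra_simps)
  finally show ?thesis
    by (simp only: U3_trisection)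
qed

subsection \<open>The four evaluations\<close>

lemma U3_xi_Xs_0: "U3 (xi * Xs ^ 0) = 9 * Xs"
proof -
  have "U3 (xi * Xs ^ 0) = 9 * Xs ^ 1"
  proof (rule U3_xi_Xs_power[where m = 1])
    \<comment> \<open>The expansion is 1 + 4t + 9t^2 + 10t^3 + 4t^4, sorted by exponents 2, 0, 1 mod
      3.\<close>
    show "(1 + par) ^ 2 * (1 + 2 * par + 4 * par ^ 2) ^ 1 = par ^ 2 * fls_compose_power 9 3
        + fls_compose_power (1 + 10 * par_cube) 3 + par * fls_compose_power (4 + 4 * par_cube) 3"
      by (simp add: par_cube_compose_cube fls_compose_power_numeral, algebra)
  qed simp_all
  thus ?thesis by simp
qed

text \<open>With \<open>z = t\<^sup>3 X\<close> (after \<open>q\<^sup>3 \<mapsto> q\<close>), the relation \<open>X (1 - 8t\<^sup>3) = 1\<close> becomes \<open>X = 1 + 8z\<close>, which turns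
  the remaining identities into polynomial identities in \<open>z\<close>.\<close>

lemma U3_xi_Xs_1:
  "U3 (xi * Xs ^ 1) = - 9 * Xs + 252 * Xs ^ 2 - 891 * Xs ^ 3 + 729 * Xs ^ 4"
proof -
  define z where "z = par_cube * Xs"
  have Xs: "Xs = 1 + 8 * z"
    unfolding z_def using Xs_par_cube by algebra
  \<comment> \<open>The coefficient of \<open>par_cube ^ j\<close> is that of t^(3j+2) in (1 + t)^2
    (1 + 2t + 4t^2)^5; the next two lemmas use the exponents 9 and 13 in the same way.\<close>
  have "U3 (xi * Xs ^ 1) = (81 + 3312 * par_cube + 14400 * par_cube ^ 2 + 4608 * par_cube ^ 3) * Xs ^ 4"
  proof (rule U3_xi_Xs_power[where m = 5])
    show "(1 + par) ^ 2 * (1 + 2 * par + 4 * par ^ 2) ^ 5 =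
      par ^ 2 * fls_compose_power (81 + 3312 * par_cube + 14400 * par_cube ^ 2 + 4608 * par_cube ^ 3) 3
      + fls_compose_power (1 + 370 * par_cube + 6864 * par_cube ^ 2 + 14080 * par_cube ^ 3 + 1024 * par_cube ^ 4) 3
      + par * fls_compose_power (12 + 1260 * par_cube + 11232 * par_cube ^ 2 + 9984 * par_cube ^ 3) 3"
      by (simp add: par_cube_compose_cube fls_compose_power_numeral, algebra)
  qed simp_all
  also have "\<dots> = 81 * Xs ^ 4 + 3312 * z * Xs ^ 3 + 14400 * z ^ 2 * Xs ^ 2 + 4608 * z ^ 3 * Xs"
    unfolding z_def by algebra
  also have "\<dots> = - 9 * Xs + 252 * Xs ^ 2 - 891 * Xs ^ 3 + 729 * Xs ^ 4"
    unfolding Xs by algebra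
  finally show ?thesis .
qed

lemma U3_xi_Xs_2:
  "U3 (xi * Xs ^ 2) = Xs - 378 * Xs ^ 2 + 8613 * Xs ^ 3 - 54675 * Xs ^ 4
           + 138510 * Xs ^ 5 - 150903 * Xs ^ 6 + 59049 * Xs ^ 7"
proof -
  define z where "z = par_cube * Xs"
  have Xs: "Xs = 1 + 8 * z"
    unfolding z_def using Xs_par_cube by algebra
  have "U3 (xi * Xs ^ 2) = (217 + 42720 * par_cube + 1433472 * par_cube ^ 2 + 12279296 * par_cube ^ 3 + 27598848 * par_cube ^ 4
      + 12189696 * par_cube ^ 5 + 262144 * par_cube ^ 6) * Xs ^ 7"
  proof (rule U3_xi_Xs_power[where m = 9])
    show "(1 + par) ^ 2 * (1 + 2 * par + 4 * par ^ 2) ^ 9 =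
      par ^ 2 * fls_compose_power (217 + 42720 * par_cube + 1433472 * par_cube ^ 2 + 12279296 * par_cube ^ 3 + 27598848 * par_cube ^ 4
        + 12189696 * par_cube ^ 5 + 262144 * par_cube ^ 6) 3
      + fls_compose_power (1 + 1626 * par_cube + 162528 * par_cube ^ 2 + 3390464 * par_cube ^ 3 + 18779136 * par_cube ^ 4
        + 25903104 * par_cube ^ 5 + 5570560 * par_cube ^ 6) 3
      + par * fls_compose_power (20 + 9300 * par_cube + 522048 * par_cube ^ 2 + 6935296 * par_cube ^ 3 + 24674304 * par_cube ^ 4
        + 19955712 * par_cube ^ 5 + 1703936 * par_cube ^ 6) 3"
      by (simp add: par_cube_compose_cube fls_compose_power_numeral, algebra)
  qed simp_all
  also have "\<dots> = 217 * Xs ^ 7 + 42720 * z * Xs ^ 6 + 1433472 * z ^ 2 * Xs ^ 5 + 12279296 * z ^ 3 * Xs ^ 4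
      + 27598848 * z ^ 4 * Xs ^ 3 + 12189696 * z ^ 5 * Xs ^ 2 + 262144 * z ^ 6 * Xs"
    unfolding z_def by algebra
  also have "\<dots> = Xs - 378 * Xs ^ 2 + 8613 * Xs ^ 3 - 54675 * Xs ^ 4
           + 138510 * Xs ^ 5 - 150903 * Xs ^ 6 + 59049 * Xs ^ 7"
    unfolding Xs by algebra
  finally show ?thesis .
qed

lemma U3_xi_Xs_3:
  "U3 (xi * Xs ^ 3) = 147 * Xs ^ 2 - 14553 * Xs ^ 3 + 312255 * Xs ^ 4
           - 2617839 * Xs ^ 5 + 10764414 * Xs ^ 6 - 23914845 * Xs ^ 7
           + 29288304 * Xs ^ 8 - 18600435 * Xs ^ 9 + 4782969 * Xs ^ 10"
proof -
  define z where "z = par_cube * Xs"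
  have Xs: "Xs = 1 + 8 * z"
    unfolding z_def using Xs_par_cube by algebra
  have "U3 (xi * Xs ^ 3) = (417 + 216528 * par_cube + 21388224 * par_cube ^ 2 + 661300224 * par_cube ^ 3 + 7618473984 * par_cube ^ 4
      + 34134097920 * par_cube ^ 5 + 56229888000 * par_cube ^ 6 + 28053602304 * par_cube ^ 7
      + 2466250752 * par_cube ^ 8) * Xs ^ 10"
  proof (rule U3_xi_Xs_power[where m = 13])
    show "(1 + par) ^ 2 * (1 + 2 * par + 4 * par ^ 2) ^ 13 =
      par ^ 2 * fls_compose_power (417 + 216528 * par_cube + 21388224 * par_cube ^ 2 + 661300224 * par_cube ^ 3 + 7618473984 * par_cube ^ 4
        + 34134097920 * par_cube ^ 5 + 56229888000 * par_cube ^ 6 + 28053602304 * par_cube ^ 7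
        + 2466250752 * par_cube ^ 8) 3
      + fls_compose_power (1 + 4290 * par_cube + 1161264 * par_cube ^ 2 + 75449088 * par_cube ^ 3 + 1659740160 * par_cube ^ 4
        + 13958651904 * par_cube ^ 5 + 45321289728 * par_cube ^ 6 + 51731496960 * par_cube ^ 7
        + 15867052032 * par_cube ^ 8 + 570425344 * par_cube ^ 9) 3
      + par * fls_compose_power (28 + 33852 * par_cube + 5340192 * par_cube ^ 2 + 236341248 * par_cube ^ 3 + 3746697216 * par_cube ^ 4
        + 23026778112 * par_cube ^ 5 + 53643313152 * par_cube ^ 6 + 41262514176 * par_cube ^ 7
        + 7197425664 * par_cube ^ 8 + 67108864 * par_cube ^ 9) 3"
      by (simp add: par_cube_compose_cube fls_compose_power_numeral, algebra)
  qed simp_all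
  \<comment> \<open>The polynomial has degree 8 in \<open>par_cube\<close>, so at least X^2 remains
    in every term; this is why the result starts at X^2.\<close>
  also have "\<dots> = 417 * Xs ^ 10 + 216528 * z * Xs ^ 9 + 21388224 * z ^ 2 * Xs ^ 8 + 661300224 * z ^ 3 * Xs ^ 7
      + 7618473984 * z ^ 4 * Xs ^ 6 + 34134097920 * z ^ 5 * Xs ^ 5 + 56229888000 * z ^ 6 * Xs ^ 4
      + 28053602304 * z ^ 7 * Xs ^ 3 + 2466250752 * z ^ 8 * Xs ^ 2"
    unfolding z_def by algebra
  also have "\<dots> = 147 * Xs ^ 2 - 14553 * Xs ^ 3 + 312255 * Xs ^ 4
           - 2617839 * Xs ^ 5 + 10764414 * Xs ^ 6 - 23914845 * Xs ^ 7
           + 29288304 * Xs ^ 8 - 18600435 * Xs ^ 9 + 4782969 * Xs ^ 10"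
    unfolding Xs by algebra
  finally show ?thesis .
qed

theorem theorem2p4:
  shows "U3 xi = 9 * Xs \<and>
    U3 (xi * Xs) = - 9 * Xs + 252 * Xs ^ 2 - 891 * Xs ^ 3 + 729 * Xs ^ 4 \<and>
    U3 (xi * Xs ^ 2) = Xs - 378 * Xs ^ 2 + 8613 * Xs ^ 3 - 54675 * Xs ^ 4
           + 138510 * Xs ^ 5 - 150903 * Xs ^ 6 + 59049 * Xs ^ 7 \<and>
    U3 (xi * Xs ^ 3) = 147 * Xs ^ 2 - 14553 * Xs ^ 3 + 312255 * Xs ^ 4
           - 2617839 * Xs ^ 5 + 10764414 * Xs ^ 6 - 23914845 * Xs ^ 7
           + 29288304 * Xs ^ 8 - 18600435 * Xs ^ 9 + 4782969 * Xs ^ 10"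
  using U3_xi_Xs_0 U3_xi_Xs_1 U3_xi_Xs_2 U3_xi_Xs_3
  by (simp only: power_0 power_one_right mult_1_right simp_thms)

end
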